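(* Let $n$ be a positive integer, $G:=\mathcal{W}^*(K_n)$, and $\mathbf{x}\in\mathbb{Z}^{2n+1}$. Then $\frac{1}{2n+1}\mathbf{x}\in\Lambda(\mathcal{P}_G)$ if and only if all of the following hold: (1) $0\le x_i\le 2n$ for all $i\in[2n+1]$; (2) for each $n+1\le i\le 2n$ there exists $k_i\in\mathbb{Z}$ such that $x_i=(n+1)x_{i-n}-\sum_{j=1}^n x_j-(2n+1)k_i$; (3) for each $j\in[n]$ there exists $m_j\in\mathbb{Z}$ such that $x_{2n+1}=2x_{j+n}-x_j-(2n+1)m_j$.
   Context: $K_n$ is the complete graph on $[n]$; $\mathcal{W}^*(K_n)$ is the graph on $[2n+1]$ whose edges are those of $K_n$, the edges $\{i,i+n\}$ for $i\in[n]$, and the edges $\{i,2n+1\}$ for $n+1\le i\le 2n$. The Laplacian matrix $L$ of a simple graph on $[m]$ has $L_{ii}=\deg(i)$, $L_{ij}=-1$ if $\{i,j\}$ is an edge and $0$ otherwise; the Laplacian simplex $\mathcal{P}_G$ is the convex hull in $\mathbb{R}^{m-1}$ of the rows $\mathbf{v}_1,\dots,\mathbf{v}_m$ (in order) of $L$ with its $m$-th column deleted. $\Lambda(\mathcal{P}_G)$ is the set of $\lambda\in[0,1)^m$ with $\sum_i\lambda_i(\mathbf{v}_i,1)\in\mathbb{Z}^m$. *)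

theory Defs
  imports Complex_Main "HOL-Library.FuncSet"
begin

text \<open>
  A simple graph on \<open>[m] = {1..m}\<close> is given by \<open>m\<close> and its set of edges, each a two-element
  subset of \<open>{1..m}\<close>. Vectors of \<open>\<real>\<^sup>d\<close> are functions on the index set \<open>{1..d}\<close>, extended by
  \<open>undefined\<close> outside it.
\<close>

definition complete_edges :: "nat \<Rightarrow> nat set set" where
  "complete_edges n = {{i, j} | i j. i \<in> {1..n} \<and> j \<in> {1..n} \<and> i \<noteq> j}"

definition W_star :: "nat \<Rightarrow> nat set set \<Rightarrow> nat set set" where
  "W_star n E =
     E \<union> {{i, i + n} | i. i \<in> {1..n}} \<union> {{i, 2 * n + 1} | i. i \<in> {n + 1..2 * n}}"

definition degree :: "nat set set \<Rightarrow> nat \<Rightarrow> nat" where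
  "degree E i = card {e \<in> E. i \<in> e}"

definition laplacian :: "nat set set \<Rightarrow> nat \<Rightarrow> nat \<Rightarrow> real" where
  "laplacian E i j =
     (if i = j then real (degree E i) else if {i, j} \<in> E then -1 else 0)"

text \<open>
  The \<open>i\<close>-th vertex of the Laplacian simplex of a graph on \<open>[m]\<close>, a vector of \<open>\<real>\<^sup>m\<^sup>-\<^sup>1\<close>.
\<close>

definition laplacian_vertex :: "nat \<Rightarrow> nat set set \<Rightarrow> nat \<Rightarrow> nat \<Rightarrow> real" where
  "laplacian_vertex m E i = (\<lambda>j\<in>{1..m - 1}. laplacian E i j)"

text \<open>The lift \<open>(v, 1)\<close> of \<open>v \<in> \<real>\<^sup>d\<close> to \<open>\<real>\<^sup>d\<^sup>+\<^sup>1\<close>.\<close>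

definition lift_one :: "nat \<Rightarrow> (nat \<Rightarrow> real) \<Rightarrow> nat \<Rightarrow> real" where
  "lift_one d v = (\<lambda>j\<in>{1..d + 1}. if j = d + 1 then 1 else v j)"

text \<open>
  The set \<open>\<Lambda>\<close> of the simplex in \<open>\<real>\<^sup>m\<^sup>-\<^sup>1\<close> with vertices \<open>v 1, \<dots>, v m\<close>. It depends on the order
  of the vertices, so its argument is the vertex sequence and not the convex hull.
\<close>

definition Lambda_simplex :: "nat \<Rightarrow> (nat \<Rightarrow> nat \<Rightarrow> real) \<Rightarrow> (nat \<Rightarrow> real) set" where
  "Lambda_simplex m v =
     {l \<in> {1..m} \<rightarrow>\<^sub>E {0..<1}.
        \<forall>j\<in>{1..m}. (\<Sum>i = 1..m. l i * lift_one (m - 1) (v i) j) \<in> \<int>}"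

definition Lambda_laplacian :: "nat \<Rightarrow> nat set set \<Rightarrow> (nat \<Rightarrow> real) set" where
  "Lambda_laplacian m E = Lambda_simplex m (laplacian_vertex m E)"

end

theory Submission
  imports Defs
begin

text \<open>
  Column \<open>j\<close> of the Laplacian pairs with a weight \<open>l\<close> to the sum of the differences \<open>l j - l k\<close>
  over the neighbours \<open>k\<close> of \<open>j\<close>. For \<open>l = x / (2 n + 1)\<close>, integrality in the columns \<open>j \<le> n\<close>
  is condition (2), and in the columns \<open>n < j \<le> 2 n\<close> it is condition (3). The remaining
  condition, that the sum of all \<open>x i\<close> is divisible by \<open>2 n + 1\<close>, is redundant: summing (2) and (3)
  over \<open>[n]\<close> gives \<open>U \<equiv> S\<close> and \<open>n x\<^bsub>2n+1\<^esub> \<equiv> 2 U - S \<equiv> S\<close> for \<open>S = x\<^sub>1 + \<dots> + x\<^sub>n\<close> and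
  \<open>U = x\<^bsub>n+1\<^esub> + \<dots> + x\<^bsub>2n\<^esub>\<close>, whence \<open>S + U + x\<^bsub>2n+1\<^esub> \<equiv> (2 n + 1) x\<^bsub>2n+1\<^esub> \<equiv> 0\<close>.
\<close>

text \<open>The condition \<open>j \<noteq> i\<close> excludes the degenerate pair
  \<open>{i, i} = {i}\<close>, so that neighbours match exactly the off-diagonal entries -1.\<close>

definition neighbours :: "nat set set \<Rightarrow> nat \<Rightarrow> nat set" where
  "neighbours E i = {j. j \<noteq> i \<and> {i, j} \<in> E}"

text \<open>Since every edge has two elements, an edge through \<open>i\<close> determines its other
  end, so edges at \<open>i\<close> and neighbours of \<open>i\<close> are in bijection.\<close>

lemma degree_eq_card_neighbours:
  assumes "\<And>e. e \<in> E \<Longrightarrow> card e = 2"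
  shows "degree E i = card (neighbours E i)"
proof -
  have "{e \<in> E. i \<in> e} = (\<lambda>j. {i, j}) ` neighbours E i"
  proof (intro equalityI subsetI)
    fix e assume e: "e \<in> {e \<in> E. i \<in> e}"
    then obtain a b where "e = {a, b}" "a \<noteq> b"
      using assms card_2_iff by (metis (lifting) mem_Collect_eq)
    with e show "e \<in> (\<lambda>j. {i, j}) ` neighbours E i"
      by (auto simp: neighbours_def insert_commute)
  qed (auto simp: neighbours_def)
  moreover have "inj_on (\<lambda>j. {i, j}) (neighbours E i)"
    by (auto simp: inj_on_def doubleton_eq_iff)
  ultimately show ?thesis
    by (simp add: degree_def card_image)
qed

text \<open>The diagonal entry counts the neighbours of \<open>j\<close>, so it provides one copy of
  \<open>l j\<close> to pair with each \<open>- l k\<close>.\<close>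

lemma sum_laplacian_column:
  assumes E: "\<And>e. e \<in> E \<Longrightarrow> card e = 2 \<and> e \<subseteq> V"
    and "finite V" and "j \<in> V"
  shows "(\<Sum>i\<in>V. l i * laplacian E i j) = (\<Sum>k\<in>neighbours E j. l j - l k)"
proof -
  have sub: "neighbours E j \<subseteq> V - {j}"
    using E by (force simp: neighbours_def)
  have "(\<Sum>i\<in>V. l i * laplacian E i j)
      = l j * laplacian E j j + (\<Sum>i\<in>V - {j}. l i * laplacian E i j)"
    using assms(2,3) by (rule sum.remove)
  also have "(\<Sum>i\<in>V - {j}. l i * laplacian E i j) = (\<Sum>k\<in>neighbours E j. - l k)"
    by (rule sum.mono_neutral_cong_right)
       (use assms(2) sub in \<open>auto simp: laplacian_def neighbours_def insert_commute\<close>)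
  also have "laplacian E j j = real (card (neighbours E j))"
    using E by (simp add: laplacian_def degree_eq_card_neighbours)
  finally show ?thesis
    by (simp add: sum_subtractf sum_negf mult.commute)
qed

lemma W_star_complete_edge:
  assumes "e \<in> W_star n (complete_edges n)"
  shows "card e = 2 \<and> e \<subseteq> {1..2 * n + 1}"
  using assms by (auto simp: W_star_def complete_edges_def)

lemma neighbours_base:
  assumes "j \<in> {1..n}"
  shows "neighbours (W_star n (complete_edges n)) j = insert (j + n) ({1..n} - {j})"
  using assms
  by (auto simp: neighbours_def W_star_def complete_edges_def doubleton_eq_iff) blast+

lemma neighbours_copy:
  assumes "j \<in> {1..n}"
  shows "neighbours (W_star n (complete_edges n)) (j + n) = {j, 2 * n + 1}"
  using assms
  by (auto simp: neighbours_def W_star_def complete_edges_def doubleton_eq_iff)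

lemma sum_column_base:
  assumes "j \<in> {1..n}"
  shows "(\<Sum>i = 1..2 * n + 1. l i * laplacian (W_star n (complete_edges n)) i j)
    = (real n + 1) * l j - (\<Sum>i = 1..n. l i) - l (j + n)"
proof -
  have "(\<Sum>i = 1..2 * n + 1. l i * laplacian (W_star n (complete_edges n)) i j)
      = (\<Sum>k\<in>insert (j + n) ({1..n} - {j}). l j - l k)"
    using assms by (subst sum_laplacian_column)
      (use W_star_complete_edge neighbours_base in auto)
  also have "\<dots> = (l j - l (j + n)) + (\<Sum>k\<in>{1..n} - {j}. l j - l k)"
    using assms by (subst sum.insert) auto
  \<comment> \<open>The term at \<open>k = j\<close> vanishes. Completing the range yields
    \<open>n\<close> copies of \<open>l j\<close>; the edge to \<open>j + n\<close> gives one
    more.\<close>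
  also have "(\<Sum>k\<in>{1..n} - {j}. l j - l k) = (\<Sum>k = 1..n. l j - l k)"
    by (rule sum.mono_neutral_left) auto
  finally show ?thesis
    by (simp add: sum_subtractf algebra_simps)
qed

lemma sum_column_copy:
  assumes "j \<in> {1..n}"
  shows "(\<Sum>i = 1..2 * n + 1. l i * laplacian (W_star n (complete_edges n)) i (j + n))
    = 2 * l (j + n) - l j - l (2 * n + 1)"
  using assms by (subst sum_laplacian_column)
    (use W_star_complete_edge neighbours_copy in auto)

text \<open>The three integrality conditions come from the columns of the base vertices, the columns
  of their copies, and the appended coordinate.\<close>

lemma Lambda_laplacian_W_star_iff:
  "l \<in> Lambda_laplacian (2 * n + 1) (W_star n (complete_edges n)) \<longleftrightarrow>
     l \<in> {1..2 * n + 1} \<rightarrow>\<^sub>E {0..<1} \<and>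
     (\<forall>j\<in>{1..n}. (real n + 1) * l j - (\<Sum>i = 1..n. l i) - l (j + n) \<in> \<int>) \<and>
     (\<forall>j\<in>{1..n}. 2 * l (j + n) - l j - l (2 * n + 1) \<in> \<int>) \<and>
     (\<Sum>i = 1..2 * n + 1. l i) \<in> \<int>"
proof -
  define E where "E = W_star n (complete_edges n)"
  define c where "c j = (\<Sum>i = 1..2 * n + 1.
      l i * lift_one (2 * n + 1 - 1) (laplacian_vertex (2 * n + 1) E i) j)" for j
  have split: "{1..2 * n + 1} = {1..n} \<union> (\<lambda>j. j + n) ` {1..n} \<union> {2 * n + 1}"
    unfolding image_add_atLeastAtMost' by auto
  have lap: "c j = (\<Sum>i = 1..2 * n + 1. l i * laplacian E i j)" if "j \<in> {1..2 * n}" for j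
    using that unfolding c_def lift_one_def laplacian_vertex_def
    by (intro sum.cong) auto
  have base: "c j = (real n + 1) * l j - (\<Sum>i = 1..n. l i) - l (j + n)" if "j \<in> {1..n}" for j
    using that lap[of j] sum_column_base[OF that] by (simp add: E_def)
  have copy: "c (j + n) = 2 * l (j + n) - l j - l (2 * n + 1)" if "j \<in> {1..n}" for j
    using that lap[of "j + n"] sum_column_copy[OF that] by (simp add: E_def)
  \<comment> \<open>Here the last Laplacian column has been deleted and the coordinate is the
    constant 1 of the lift, which leaves the plain sum of weights.\<close>
  have total: "c (2 * n + 1) = (\<Sum>i = 1..2 * n + 1. l i)"
    by (simp add: c_def lift_one_def)
  have "l \<in> Lambda_laplacian (2 * n + 1) E \<longleftrightarrow>
      l \<in> {1..2 * n + 1} \<rightarrow>\<^sub>E {0..<1} \<and> (\<forall>j\<in>{1..2 * n + 1}. c j \<in> \<int>)"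
    by (simp only: Lambda_laplacian_def Lambda_simplex_def mem_Collect_eq c_def)
  also have "(\<forall>j\<in>{1..2 * n + 1}. c j \<in> \<int>) \<longleftrightarrow>
      (\<forall>j\<in>{1..n}. c j \<in> \<int>) \<and> (\<forall>j\<in>{1..n}. c (j + n) \<in> \<int>) \<and> c (2 * n + 1) \<in> \<int>"
    unfolding split by blast
  finally show ?thesis
    by (simp only: E_def base copy total cong: ball_cong)
qed

lemma divide_in_Ints_iff:
  fixes a :: int
  assumes "m > 0"
  shows "real_of_int a / real m \<in> \<int> \<longleftrightarrow> int m dvd a"
proof
  assume "real_of_int a / real m \<in> \<int>"
  then obtain k where "real_of_int a / real m = of_int k"
    by (elim Ints_cases)
  with assms have "real_of_int a = real_of_int (int m * k)"
    by (simp add: field_simps)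
  then show "int m dvd a"
    by (metis dvd_triv_left of_int_eq_iff)
next
  assume "int m dvd a"
  then show "real_of_int a / real m \<in> \<int>"
    using assms by (auto elim!: dvdE)
qed

text \<open>Turns conditions (2) and (3) of the theorem into divisibility statements.\<close>

lemma ex_eq_diff_mult_iff_dvd:
  fixes a b d :: int
  shows "(\<exists>k. a = b - d * k) \<longleftrightarrow> d dvd b - a"
  by (auto simp: dvd_def algebra_simps)

lemma sum_dvd_of_columns:
  fixes x :: "nat \<Rightarrow> int"
  assumes base: "\<And>j. j \<in> {1..n} \<Longrightarrow>
      2 * int n + 1 dvd (int n + 1) * x j - (\<Sum>i = 1..n. x i) - x (j + n)"
    and copy: "\<And>j. j \<in> {1..n} \<Longrightarrow> 2 * int n + 1 dvd 2 * x (j + n) - x j - x (2 * n + 1)"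
  shows "2 * int n + 1 dvd (\<Sum>i = 1..2 * n + 1. x i)"
proof -
  define S where "S = (\<Sum>i = 1..n. x i)"
  define U where "U = (\<Sum>i = 1..n. x (i + n))"
  define z where "z = x (2 * n + 1)"
  have "2 * int n + 1 dvd (\<Sum>j = 1..n. (int n + 1) * x j - S - x (j + n))"
    unfolding S_def by (intro dvd_sum base)
  also have "\<dots> = (int n + 1) * S - int n * S - U"
    by (simp add: sum_subtractf S_def U_def sum_distrib_left)
  also have "\<dots> = S - U"
    by (simp add: algebra_simps)
  finally have SU: "2 * int n + 1 dvd S - U" .
  have "2 * int n + 1 dvd (\<Sum>j = 1..n. 2 * x (j + n) - x j - z)"
    unfolding z_def by (intro dvd_sum copy)
  also have "\<dots> = 2 * U - S - int n * z"
    by (simp add: sum_subtractf S_def U_def sum_distrib_left)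
  finally have Uz: "2 * int n + 1 dvd 2 * U - S - int n * z" .
  have "(\<Sum>i = 1..2 * n + 1. x i) = S + (\<Sum>i = n + 1..2 * n. x i) + z"
    using sum.ub_add_nat[of 1 n x n] by (simp add: S_def z_def mult_2)
  also have "(\<Sum>i = n + 1..2 * n. x i) = U"
    using sum.shift_bounds_cl_nat_ivl[of x 1 n n] by (simp add: U_def mult_2 add.commute)
  \<comment> \<open>The factor 2 turns \<open>- int n * z\<close> into
    \<open>- 2 * int n * z\<close>, which leaves a single \<open>z\<close> from the first summand;
    the factor 3 then corrects \<open>4 * U - 2 * S\<close> to \<open>S + U\<close>.\<close>
  also have "S + U + z = (2 * int n + 1) * z + 2 * (2 * U - S - int n * z) + 3 * (S - U)"
    by (simp add: algebra_simps)
  finally show ?thesis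
    using SU Uz by (simp only: dvd_add dvd_mult dvd_triv_left)
qed

theorem theorem3p27:
  fixes n :: nat and x :: "nat \<Rightarrow> int"
  assumes "n \<ge> 1"
  shows "(\<lambda>i\<in>{1..2 * n + 1}. 1 / real (2 * n + 1) * real_of_int (x i))
           \<in> Lambda_laplacian (2 * n + 1) (W_star n (complete_edges n)) \<longleftrightarrow>
         (\<forall>i\<in>{1..2 * n + 1}. 0 \<le> x i \<and> x i \<le> 2 * int n) \<and>
         (\<forall>i\<in>{n + 1..2 * n}. \<exists>k::int.
            x i = (int n + 1) * x (i - n) - (\<Sum>j = 1..n. x j) - (2 * int n + 1) * k) \<and>
         (\<forall>j\<in>{1..n}. \<exists>m::int.
            x (2 * n + 1) = 2 * x (j + n) - x j - (2 * int n + 1) * m)"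
proof -
  define N where "N = 2 * n + 1"
  define l where "l = (\<lambda>i\<in>{1..2 * n + 1}. 1 / real (2 * n + 1) * real_of_int (x i))"
  have N: "N > 0" "int N = 2 * int n + 1"
    by (simp_all add: N_def)
  have l: "l i = real_of_int (x i) / real N" if "i \<in> {1..2 * n + 1}" for i
    using that by (simp add: l_def N_def)
  \<comment> \<open>For integers, the strict bound \<open>a < N\<close> with
    \<open>N = 2 * n + 1\<close> is the bound \<open>2 * n\<close> of condition (1).\<close>
  have unit: "0 \<le> real_of_int a / real N \<and> real_of_int a / real N < 1
      \<longleftrightarrow> 0 \<le> a \<and> a \<le> 2 * int n" for a
  proof -
    have "real_of_int a / real N < 1 \<longleftrightarrow> real_of_int a < real_of_int (int N)"
      using N(1) by simp
    then show ?thesis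
      using N by (auto simp: zero_le_divide_iff)
  qed
  have range: "l \<in> {1..2 * n + 1} \<rightarrow>\<^sub>E {0..<1} \<longleftrightarrow>
      (\<forall>i\<in>{1..2 * n + 1}. 0 \<le> x i \<and> x i \<le> 2 * int n)"
  proof -
    have "l \<in> {1..2 * n + 1} \<rightarrow>\<^sub>E {0..<1} \<longleftrightarrow> (\<forall>i\<in>{1..2 * n + 1}. 0 \<le> l i \<and> l i < 1)"
      by (auto simp: PiE_iff l_def)
    also have "\<dots> \<longleftrightarrow> (\<forall>i\<in>{1..2 * n + 1}. 0 \<le> x i \<and> x i \<le> 2 * int n)"
      by (intro ball_cong refl) (simp only: l unit)
    finally show ?thesis .
  qed
  have sums: "(\<Sum>i\<in>A. l i) = real_of_int (\<Sum>i\<in>A. x i) / real N" if "A \<subseteq> {1..2 * n + 1}" for A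
    using that by (auto simp: sum_divide_distrib intro!: sum.cong l)
  have base: "(real n + 1) * l j - (\<Sum>i = 1..n. l i) - l (j + n) \<in> \<int> \<longleftrightarrow>
      int N dvd (int n + 1) * x j - (\<Sum>i = 1..n. x i) - x (j + n)" if "j \<in> {1..n}" for j
  proof -
    have "(real n + 1) * l j - (\<Sum>i = 1..n. l i) - l (j + n) =
        real_of_int ((int n + 1) * x j - (\<Sum>i = 1..n. x i) - x (j + n)) / real N"
      using that sums[of "{1..n}"] by (simp add: l diff_divide_distrib del: of_int_sum)
    then show ?thesis
      by (simp only: divide_in_Ints_iff[OF N(1)])
  qed
  have copy: "2 * l (j + n) - l j - l (2 * n + 1) \<in> \<int> \<longleftrightarrow>
      int N dvd 2 * x (j + n) - x j - x (2 * n + 1)" if "j \<in> {1..n}" for j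
  proof -
    have "2 * l (j + n) - l j - l (2 * n + 1) =
        real_of_int (2 * x (j + n) - x j - x (2 * n + 1)) / real N"
      using that by (simp add: l diff_divide_distrib)
    then show ?thesis
      by (simp only: divide_in_Ints_iff[OF N(1)])
  qed
  have total: "(\<Sum>i = 1..2 * n + 1. l i) \<in> \<int> \<longleftrightarrow> int N dvd (\<Sum>i = 1..2 * n + 1. x i)"
    by (simp only: sums[OF subset_refl] divide_in_Ints_iff[OF N(1)])
  \<comment> \<open>Reindexing condition (2) by \<open>i = j + n\<close> turns the truncated
    difference \<open>i - n\<close> into \<open>j\<close>, the index of the base columns.\<close>
  have shift: "(\<forall>i\<in>{n + 1..2 * n}. P i) \<longleftrightarrow> (\<forall>j\<in>{1..n}. P (j + n))" for P
  proof -
    have "{n + 1..2 * n} = (\<lambda>j. j + n) ` {1..n}"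
      unfolding image_add_atLeastAtMost' by (simp add: mult_2)
    then show ?thesis
      by (metis (no_types, lifting) image_iff)
  qed
  show ?thesis
    unfolding l_def[symmetric] Lambda_laplacian_W_star_iff range total shift
      ex_eq_diff_mult_iff_dvd N(2)[symmetric]
    \<comment> \<open>The column conditions match one by one; from right to left, integrality of the
      total weight follows by \<open>sum_dvd_of_columns\<close>.\<close>
    using base copy sum_dvd_of_columns[of n x] by (auto simp: N(2))
qed

end
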